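(* Let $s\geqslant 2$ and $n\geqslant 1$ be integers. Let $H^{(s-1)}_n=\{1_1,\ldots,1_{s-1},2_1,\ldots,2_{s-1},\ldots,(n-1)_1,\ldots,(n-1)_{s-1},n\}$, a set of $(s-1)(n-1)+1$ distinct elements, where $i_j$ denotes the integer $i$ carrying color $j\in\{1,\ldots,s-1\}$ and $n$ is uncolored. Let $\mathcal{C}^{(s-1)}_n$ be the collection of subsets $C\subset H^{(s-1)}_n$ such that $n\in C$ and $\min C\geqslant |C|$. Then $|\mathcal{C}^{(s-1)}_n| = K^{(s)}_{(s-1)(n-1)+1}$.
   Context: The minimum $\min C$ is taken with respect to the underlying integer values (the value of $i_j$ is $i$). For $u\geqslant 2$, the sequence $(K^{(u)}_m)_{m\geqslant 1}$ is defined by $K^{(u)}_1=\cdots=K^{(u)}_u=1$ and $K^{(u)}_m=K^{(u)}_{m-1}+K^{(u)}_{m-u}$ for $m\geqslant u+1$. *)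

theory Defs
  imports Main
begin

text \<open>
  An integer together with an optional colour: \<open>(i, Some j)\<close> is $i_j$, the integer \<open>i\<close> carrying
  colour \<open>j\<close>, and \<open>(i, None)\<close> is the uncoloured integer \<open>i\<close>.
\<close>

type_synonym colored = "nat \<times> nat option"

abbreviation val :: "colored \<Rightarrow> nat" where
  "val \<equiv> fst"

text \<open>In \<open>H c n\<close> and \<open>CC c n\<close> the parameter \<open>c\<close> is the number of colours.\<close>

definition H :: "nat \<Rightarrow> nat \<Rightarrow> colored set" where
  "H c n = {(i, Some j) | i j. 1 \<le> i \<and> i \<le> n - 1 \<and> 1 \<le> j \<and> j \<le> c} \<union> {(n, None)}"

definition CC :: "nat \<Rightarrow> nat \<Rightarrow> colored set set" where
  "CC c n = {C. C \<subseteq> H c n \<and> (n, None) \<in> C \<and> Min (val ` C) \<ge> card C}"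

text \<open>
  The sequence \<open>K u m\<close> is meant for \<open>u \<ge> 2\<close> and \<open>m \<ge> 1\<close>; the values for \<open>u = 0\<close> and for \<open>m = 0\<close>
  are irrelevant and only make the function total.
\<close>

function K :: "nat \<Rightarrow> nat \<Rightarrow> nat" where
  "K u m = (if u = 0 \<or> m \<le> u then 1 else K u (m - 1) + K u (m - u))"
  by pat_completeness auto
termination
  by (relation "measure snd") auto

declare K.simps [simp del]

lemma K_init: "1 \<le> m \<Longrightarrow> m \<le> u \<Longrightarrow> K u m = 1"
  by (simp add: K.simps)

lemma K_rec: "u \<ge> 2 \<Longrightarrow> m \<ge> u + 1 \<Longrightarrow> K u m = K u (m - 1) + K u (m - u)"
  by (subst K.simps) auto

lemma H_eq: "H c n = (\<lambda>(i, j). (i, Some j)) ` ({1..n - 1} \<times> {1..c}) \<union> {(n, None)}"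
  by (auto simp: H_def)

lemma finite_H: "finite (H c n)"
  by (simp add: H_eq)

lemma card_H: "card (H c n) = c * (n - 1) + 1"
proof -
  have "inj_on (\<lambda>(i, j). (i, Some j)) ({1..n - 1} \<times> {1..c})"
    by (auto simp: inj_on_def)
  hence "card ((\<lambda>(i, j). (i, Some j)) ` ({1..n - 1} \<times> {1..c})) = (n - 1) * c"
    by (simp add: card_image)
  thus ?thesis
    unfolding H_eq by (subst card_Un_disjoint) (auto simp: mult.commute)
qed

end

theory Submission
  imports Defs
begin

text \<open>
  Removing the uncoloured \<open>n\<close> from \<open>C\<close> leaves a set of some size \<open>k\<close> all of whose values lie in
  \<open>{k + 1..n - 1}\<close>, and conversely; with \<open>c = s - 1\<close> colours this gives
  \<open>\<Sum>k. c (n - 1 - k) choose k\<close> sets. On the other hand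
  \<open>K (c + 1) (m + 1) = \<Sum>k. (m - c k) choose k\<close> (tilings of length \<open>m\<close> by pieces of length
  \<open>1\<close> and \<open>c + 1\<close>), which follows from Pascal's rule; take \<open>m = c (n - 1)\<close>.
\<close>

text \<open>The terms with \<open>k > m\<close> vanish because \<open>m - c * k \<le> m < k\<close>.
  This lets sums with different upper limits be compared.\<close>

lemma sum_choose_extend:
  fixes m c M :: nat
  assumes "m \<le> M"
  shows "(\<Sum>k\<le>M. (m - c * k) choose k) = (\<Sum>k\<le>m. (m - c * k) choose k)"
  by (rule sum.mono_neutral_right) (use assms in \<open>auto intro: binomial_eq_0\<close>)

lemma pascal_shifted:
  fixes m c k :: nat
  assumes "c \<le> m"
  shows "(Suc m - c * Suc k) choose Suc k =
    ((m - c * Suc k) choose Suc k) + ((m - c - c * k) choose k)"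
proof (cases "c * Suc k \<le> m")
  case True
  then show ?thesis by (simp add: Suc_diff_le add.commute)
next
  case False
  \<comment> \<open>All upper arguments are truncated to 0 here, and \<open>0 choose k\<close> would
    be 1 for \<open>k = 0\<close>; that case would force \<open>c > m\<close>.\<close>
  with assms have "k > 0" by (cases k) auto
  with False show ?thesis by (simp add: binomial_eq_0)
qed

lemma sum_choose_rec:
  fixes m c :: nat
  assumes "c \<le> m"
  shows "(\<Sum>k\<le>Suc m. (Suc m - c * k) choose k) =
    (\<Sum>k\<le>m. (m - c * k) choose k) + (\<Sum>k\<le>m - c. (m - c - c * k) choose k)"
proof -
  have "(\<Sum>k\<le>Suc m. (Suc m - c * k) choose k) =
      1 + (\<Sum>k\<le>m. ((m - c * Suc k) choose Suc k) + ((m - c - c * k) choose k))"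
    by (subst sum.atMost_Suc_shift) (simp only: pascal_shifted[OF assms], simp)
  \<comment> \<open>The leading 1 is the term \<open>k = 0\<close>, absorbed back into the first
    sum.\<close>
  also have "\<dots> = (\<Sum>k\<le>Suc m. (m - c * k) choose k) + (\<Sum>k\<le>m. (m - c - c * k) choose k)"
    by (subst sum.atMost_Suc_shift) (simp add: sum.distrib)
  also have "\<dots> = (\<Sum>k\<le>m. (m - c * k) choose k) + (\<Sum>k\<le>m - c. (m - c - c * k) choose k)"
    using sum_choose_extend[of m "Suc m" c] sum_choose_extend[of "m - c" m c] by simp
  finally show ?thesis .
qed

text \<open>Both sides equal 1 for \<open>m \<le> c\<close> and satisfy the same recurrence beyond,
  which reaches back \<open>c + 1\<close> places and so needs strong induction.\<close>

lemma K_eq_sum_choose: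
  assumes "c \<ge> 1"
  shows "K (Suc c) (Suc m) = (\<Sum>k\<le>m. (m - c * k) choose k)"
proof (induction m rule: less_induct)
  case (less m)
  show ?case
  proof (cases "m \<le> c")
    case True
    have "(m - c * k) choose k = 0" if "k \<noteq> 0" for k
      using True that by (cases k) auto
    then have "(\<Sum>k\<le>m. (m - c * k) choose k) = (\<Sum>k\<in>{0}. (m - c * k) choose k)"
      by (intro sum.mono_neutral_right) auto
    with True show ?thesis by (simp add: K_init)
  next
    case False
    then obtain l where l: "m = Suc l" "c \<le> l" by (cases m) auto
    have "K (Suc c) (Suc m) = K (Suc c) (Suc l) + K (Suc c) (Suc (l - c))"
      using assms l by (subst K_rec) (auto simp: Suc_diff_le)
    with l less[of l] less[of "l - c"] show ?thesis
      by (simp only: sum_choose_rec)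
  qed
qed

text \<open>The bound on \<open>i\<close> is strict because \<open>n\<close> itself adds one to the
  size: for \<open>k = card D\<close>, values must be at least \<open>k + 1\<close>.\<close>

definition H_above :: "nat \<Rightarrow> nat \<Rightarrow> nat \<Rightarrow> colored set" where
  "H_above c n k = (\<lambda>(i, j). (i, Some j)) ` ({k<..n - 1} \<times> {1..c})"

lemma finite_H_above: "finite (H_above c n k)"
  by (simp add: H_above_def)

lemma card_H_above: "card (H_above c n k) = c * (n - 1 - k)"
  unfolding H_above_def
  by (subst card_image) (auto simp: inj_on_def card_cartesian_product mult.commute)

lemma H_above_iff: "x \<in> H_above c n k \<longleftrightarrow> x \<in> H_above c n 0 \<and> k < val x"
  by (auto simp: H_above_def)

lemma val_less_if_H_above: "x \<in> H_above c n k \<Longrightarrow> val x < n"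
  by (auto simp: H_above_def)

lemma H_eq_insert_H_above: "H c n = insert (n, None) (H_above c n 0)"
  by (auto simp: H_eq H_above_def)

lemma uncolored_notin_H_above: "(i, None) \<notin> H_above c n k"
  by (auto simp: H_above_def)

lemma insert_in_CC_iff:
  assumes "n \<ge> 1" "D \<subseteq> H_above c n 0"
  shows "insert (n, None) D \<in> CC c n \<longleftrightarrow> D \<subseteq> H_above c n (card D)"
proof -
  have fin: "finite D" and notin: "(n, None) \<notin> D"
    using finite_subset[OF assms(2) finite_H_above] assms(2) uncolored_notin_H_above by blast+
  have "insert (n, None) D \<in> CC c n \<longleftrightarrow> card D < n \<and> (\<forall>x\<in>D. card D < val x)"
    using assms fin notin by (auto simp: CC_def H_eq_insert_H_above Suc_le_eq)
  also have "\<dots> \<longleftrightarrow> (\<forall>x\<in>D. card D < val x)"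
  \<comment> \<open>The condition \<open>card D < n\<close> coming from the element \<open>n\<close>
    is automatic: any \<open>x\<close> in \<open>D\<close> gives \<open>card D < val x < n\<close>,
    and for empty \<open>D\<close> it is \<open>n \<ge> 1\<close>.\<close>
  proof (cases "D = {}")
    case False
    then obtain x where "x \<in> D" by auto
    then show ?thesis
      using assms(2) val_less_if_H_above[of x c n 0] less_trans by blast
  qed (use assms in auto)
  also have "\<dots> \<longleftrightarrow> D \<subseteq> H_above c n (card D)"
    using assms(2) H_above_iff[of _ c n "card D"] by (auto simp: subset_iff)
  finally show ?thesis .
qed

lemma CC_eq_image:
  assumes "n \<ge> 1"
  shows "CC c n = insert (n, None) ` {D. D \<subseteq> H_above c n (card D)}" (is "_ = _ ` ?P")
proof (intro equalityI subsetI)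
  fix C assume C: "C \<in> CC c n"
  let ?D = "C - {(n, None)}"
  have "?D \<subseteq> H_above c n 0" and ins: "insert (n, None) ?D = C"
    using C by (auto simp: CC_def H_eq_insert_H_above)
  with C have "?D \<in> ?P"
    using insert_in_CC_iff[OF assms, of ?D c] by simp
  then have "insert (n, None) ?D \<in> insert (n, None) ` ?P" by (rule imageI)
  then show "C \<in> insert (n, None) ` ?P" by (simp only: ins)
next
  fix C assume "C \<in> insert (n, None) ` ?P"
  then obtain D where D: "D \<subseteq> H_above c n (card D)" "C = insert (n, None) D" by auto
  then have "D \<subseteq> H_above c n 0" using H_above_iff[of _ c n "card D"] by blast
  with D show "C \<in> CC c n" using insert_in_CC_iff[OF assms] by simp
qed

text \<open>The sets \<open>D\<close> left after removing \<open>n\<close> are sorted by size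
  \<open>k\<close>; those of size \<open>k\<close> are exactly the \<open>k\<close>-subsets of
  \<open>H_above c n k\<close>.\<close>

lemma card_CC:
  assumes "n \<ge> 1"
  shows "card (CC c n) = (\<Sum>k\<le>c * (n - 1). (c * (n - 1 - k)) choose k)"
proof -
  let ?P = "{D. D \<subseteq> H_above c n (card D)}"
  let ?Q = "\<lambda>k. {D. D \<subseteq> H_above c n k \<and> card D = k}"
  have "inj_on (insert (n, None)) ?P"
    using uncolored_notin_H_above by (intro inj_onI) (metis insert_ident mem_Collect_eq subsetD)
  then have "card (CC c n) = card ?P"
    by (simp add: CC_eq_image[OF assms] card_image)
  also have "?P = (\<Union>k\<le>c * (n - 1). ?Q k)"
  proof -
    have "card D \<le> c * (n - 1)" if "D \<subseteq> H_above c n (card D)" for D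
    proof -
      have "card D \<le> c * (n - 1 - card D)"
        using card_mono[OF finite_H_above that] by (simp add: card_H_above)
      also have "\<dots> \<le> c * (n - 1)" by (intro mult_le_mono) auto
      finally show ?thesis .
    qed
    then show ?thesis by auto
  qed
  also have "card \<dots> = (\<Sum>k\<le>c * (n - 1). card (?Q k))"
    by (intro card_UN_disjoint) (auto simp: finite_H_above)
  also have "\<dots> = (\<Sum>k\<le>c * (n - 1). (c * (n - 1 - k)) choose k)"
    by (simp add: n_subsets finite_H_above card_H_above)
  finally show ?thesis .
qed

theorem theorem3:
  fixes s n :: nat
  assumes "s \<ge> 2" and "n \<ge> 1"
  shows "card (CC (s - 1) n) = K s ((s - 1) * (n - 1) + 1)"
proof -
  obtain c where c: "s = Suc c" "c \<ge> 1" using assms(1) by (cases s) auto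
  then show ?thesis
    using K_eq_sum_choose[of c "c * (n - 1)"] card_CC[OF assms(2), of c]
    \<comment> \<open>Truncated subtraction still gives
      \<open>c * (n - 1 - k) = c * (n - 1) - c * k\<close>, so the two sums agree termwise.\<close>
    by (simp add: right_diff_distrib')
qed

end
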